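(* Let $A$ and $B$ be two pre-Lie algebras of dimension $n$ over a field $K$, and let $T(x_1,\ldots,x_n)$ be a (non-commutative) polynomial over $K$ in the left and right multiplication operators $L(x_1),\ldots,L(x_n)$ and $R(x_1),\ldots,R(x_n)$. Suppose that the operator identity $T(x_1,\ldots,x_n)=0$ (for all $x_1,\ldots,x_n$ in the algebra) holds for $A$ but not for $B$. Then $A$ does not degenerate to $B$.
   Context: A pre-Lie algebra over a field $K$ is a $K$-vector space with a bilinear product satisfying $(x\cdot y)\cdot z-x\cdot(y\cdot z)=(y\cdot x)\cdot z-y\cdot(x\cdot z)$ for all $x,y,z$. $L(x)\colon y\mapsto x\cdot y$ and $R(x)\colon y\mapsto y\cdot x$ denote the left and right multiplication operators in $\mathrm{End}(A)$, for $x\in A$. Fix an $n$-dimensional $K$-vector space $V$ with basis $(e_1,\dots,e_n)$. $\mathcal{P}_n(K)\subseteq K^{n^3}$ is the affine algebraic set of all structure constants $(c_{ij}^k)$ of pre-Lie algebra products $e_i\cdot e_j=\sum_k c_{ij}^k e_k$ on $V$. $GL_n(K)$ acts on it by $(g\circ\mu)(x,y)=g(\mu(g^{-1}x,g^{-1}y))$; orbits correspond to isomorphism classes. $O(\mu)$ is the orbit of $\mu$ and $\overline{O(\mu)}$ its Zariski closure. $\lambda$ degenerates to $\mu$ if $\mu\in\overline{O(\lambda)}$. An algebra $A$ degenerates to $B$ if a structure representing $A$ degenerates to one representing $B$. *)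

theory Defs
  imports "HOL-Analysis.Analysis" "HOL-Library.Poly_Mapping"
begin

locale pre_lie_algebra = vector_space scl
  for scl :: "'k::field \<Rightarrow> 'a::ab_group_add \<Rightarrow> 'a" +
  fixes mul :: "'a \<Rightarrow> 'a \<Rightarrow> 'a"
  assumes linear_mul_left: "Vector_Spaces.linear scl scl (\<lambda>x. mul x y)"
    and linear_mul_right: "Vector_Spaces.linear scl scl (\<lambda>y. mul x y)"
    and left_symmetric:
      "mul (mul x y) z - mul x (mul y z) = mul (mul y x) z - mul y (mul x z)"


text \<open>An element of the free associative unital algebra over \<open>'k\<close> on the symbols \<open>L i\<close>, \<open>R i\<close>
  is a finitely supported family of coefficients indexed by words in these symbols. A word is
  evaluated as the composition of its letters in the order written, the empty word as the identity.\<close>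

datatype 'i op_symbol = LeftMult 'i | RightMult 'i

type_synonym ('i, 'k) op_poly = "'i op_symbol list \<Rightarrow>\<^sub>0 'k"

primrec eval_symbol :: "('a \<Rightarrow> 'a \<Rightarrow> 'a) \<Rightarrow> ('i \<Rightarrow> 'a) \<Rightarrow> 'i op_symbol \<Rightarrow> 'a \<Rightarrow> 'a" where
  "eval_symbol mul x (LeftMult i) = (\<lambda>y. mul (x i) y)"
| "eval_symbol mul x (RightMult i) = (\<lambda>y. mul y (x i))"

definition eval_word :: "('a \<Rightarrow> 'a \<Rightarrow> 'a) \<Rightarrow> ('i \<Rightarrow> 'a) \<Rightarrow> 'i op_symbol list \<Rightarrow> 'a \<Rightarrow> 'a" where
  "eval_word mul x w = foldr (\<lambda>s f. eval_symbol mul x s \<circ> f) w id"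

definition eval_op_poly ::
  "('k::field \<Rightarrow> 'a::ab_group_add \<Rightarrow> 'a) \<Rightarrow> ('a \<Rightarrow> 'a \<Rightarrow> 'a) \<Rightarrow> ('i, 'k) op_poly \<Rightarrow> ('i \<Rightarrow> 'a) \<Rightarrow> 'a \<Rightarrow> 'a"
where
  "eval_op_poly scl mul T x =
     (\<lambda>y. \<Sum>w\<in>Poly_Mapping.keys T. scl (Poly_Mapping.lookup T w) (eval_word mul x w y))"

definition operator_identity ::
  "('k::field \<Rightarrow> 'a::ab_group_add \<Rightarrow> 'a) \<Rightarrow> ('a \<Rightarrow> 'a \<Rightarrow> 'a) \<Rightarrow> ('i, 'k) op_poly \<Rightarrow> bool"
where
  "operator_identity scl mul T \<longleftrightarrow> (\<forall>x. eval_op_poly scl mul T x = (\<lambda>y. 0))"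


text \<open>The Zariski closure of a set of points of affine space \<open>'v \<Rightarrow> 'k\<close> is the smallest
  algebraic set containing it. Polynomials are formal, since over a finite field they are not
  determined by their values.\<close>

type_synonym ('v, 'k) mv_poly = "('v \<Rightarrow>\<^sub>0 nat) \<Rightarrow>\<^sub>0 'k"

definition eval_mv_poly :: "('v, 'k::field) mv_poly \<Rightarrow> ('v \<Rightarrow> 'k) \<Rightarrow> 'k" where
  "eval_mv_poly p c =
     (\<Sum>m\<in>Poly_Mapping.keys p.
        Poly_Mapping.lookup p m * (\<Prod>v\<in>Poly_Mapping.keys m. c v ^ Poly_Mapping.lookup m v))"

definition algebraic_set :: "('v \<Rightarrow> 'k::field) set \<Rightarrow> bool" where
  "algebraic_set Z \<longleftrightarrow> (\<exists>P. Z = {c. \<forall>p\<in>P. eval_mv_poly p c = 0})"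

definition zariski_closure :: "('v \<Rightarrow> 'k::field) set \<Rightarrow> ('v \<Rightarrow> 'k) set" where
  "zariski_closure S = algebraic_set hull S"


text \<open>The fixed \<open>n\<close>-dimensional space is \<open>'k ^ 'n\<close> with its standard basis; the structure constant
  written with lower indices \<open>i\<close>, \<open>j\<close> and upper index \<open>k\<close> is \<open>c (i, j, k)\<close>.\<close>

type_synonym ('n, 'k) struct_consts = "'n \<times> 'n \<times> 'n \<Rightarrow> 'k"

definition product_of :: "('n::finite, 'k::field) struct_consts \<Rightarrow> 'k ^ 'n \<Rightarrow> 'k ^ 'n \<Rightarrow> 'k ^ 'n" where
  "product_of c x y = (\<chi> k. \<Sum>i\<in>UNIV. \<Sum>j\<in>UNIV. c (i, j, k) * x $ i * y $ j)"

definition consts_of :: "('k ^ 'n \<Rightarrow> 'k ^ 'n \<Rightarrow> 'k ^ 'n) \<Rightarrow> ('n::finite, 'k::field) struct_consts" where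
  "consts_of \<mu> = (\<lambda>(i, j, k). \<mu> (axis i 1) (axis j 1) $ k)"

definition pre_lie_structures :: "('n::finite, 'k::field) struct_consts set" where
  "pre_lie_structures = {c. pre_lie_algebra (*s) (product_of c)}"

definition gl_act ::
  "'k::field ^ 'n ^ 'n \<Rightarrow> ('k ^ 'n \<Rightarrow> 'k ^ 'n \<Rightarrow> 'k ^ 'n) \<Rightarrow> 'k ^ 'n \<Rightarrow> 'k ^ 'n \<Rightarrow> 'k ^ 'n::finite"
where
  "gl_act g \<mu> x y = g *v \<mu> (matrix_inv g *v x) (matrix_inv g *v y)"

definition gl_orbit :: "('n::finite, 'k::field) struct_consts \<Rightarrow> ('n, 'k) struct_consts set" where
  "gl_orbit c = {consts_of (gl_act g (product_of c)) | g. invertible g}"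

definition struct_degenerates ::
  "('n::finite, 'k::field) struct_consts \<Rightarrow> ('n, 'k) struct_consts \<Rightarrow> bool" where
  "struct_degenerates c d \<longleftrightarrow> d \<in> zariski_closure (gl_orbit c)"

definition represents ::
  "('n::finite, 'k::field) struct_consts \<Rightarrow> ('k \<Rightarrow> 'a::ab_group_add \<Rightarrow> 'a) \<Rightarrow> ('a \<Rightarrow> 'a \<Rightarrow> 'a) \<Rightarrow> bool"
where
  "represents c scl mul \<longleftrightarrow>
     (\<exists>\<phi>. Vector_Spaces.linear (*s) scl \<phi> \<and> bij \<phi> \<and>
          (\<forall>x y. \<phi> (product_of c x y) = mul (\<phi> x) (\<phi> y)))"

text \<open>The type argument fixes the index set of the basis, hence the dimension.\<close>

definition degenerates ::
  "'n::finite itself \<Rightarrow> ('k::field \<Rightarrow> 'a::ab_group_add \<Rightarrow> 'a) \<Rightarrow> ('a \<Rightarrow> 'a \<Rightarrow> 'a) \<Rightarrow>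
     ('k \<Rightarrow> 'b::ab_group_add \<Rightarrow> 'b) \<Rightarrow> ('b \<Rightarrow> 'b \<Rightarrow> 'b) \<Rightarrow> bool"
where
  "degenerates (_ :: 'n itself) sclA mulA sclB mulB \<longleftrightarrow>
     (\<exists>c \<in> (pre_lie_structures :: ('n, 'k) struct_consts set). \<exists>d \<in> pre_lie_structures.
        represents c sclA mulA \<and> represents d sclB mulB \<and> struct_degenerates c d)"

end

theory Submission imports Defs begin

text \<open>
  Once the operator arguments \<open>x\<close> and the vector \<open>y\<close> are fixed, each coordinate of
  \<open>T(x) y\<close>, computed in the product with structure constants \<open>c\<close>, is a polynomial in \<open>c\<close>: a letter
  of a word acts by the product, which is bilinear with coefficients the coordinates of \<open>c\<close>. The
  structures that satisfy the identity \<open>T = 0\<close> are the common zeros of these polynomials as \<open>x\<close> and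
  \<open>y\<close> run over all vectors, so they form a Zariski closed set
  (\<open>algebraic_set_operator_identity\<close>). Operator identities are invariant under isomorphism
  (\<open>operator_identity_iso\<close>), so this closed set contains the whole orbit of a structure representing
  \<open>A\<close>, hence also the closure of that orbit. If \<open>A\<close> degenerated to \<open>B\<close>, a structure representing
  \<open>B\<close> would lie there, and \<open>B\<close> would satisfy the identity.

  Only the coordinates of \<open>c\<close> are treated as indeterminates, while \<open>x\<close> and \<open>y\<close> are specialised to
  every possible value. The argument therefore works over finite fields as well, where a polynomial
  is not determined by its values.
\<close>

section \<open>Polynomial functions on affine space\<close>

definition mv_polynomial_function :: "(('v \<Rightarrow> 'k::field) \<Rightarrow> 'k) \<Rightarrow> bool" where
  "mv_polynomial_function f \<longleftrightarrow> (\<exists>p. \<forall>c. eval_mv_poly p c = f c)"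

definition eval_monomial :: "('v \<Rightarrow>\<^sub>0 nat) \<Rightarrow> ('v \<Rightarrow> 'k::field) \<Rightarrow> 'k" where
  "eval_monomial m c = (\<Prod>v\<in>Poly_Mapping.keys m. c v ^ Poly_Mapping.lookup m v)"

lemma eval_monomial_superset:
  assumes "finite S" "Poly_Mapping.keys m \<subseteq> S"
  shows "eval_monomial m c = (\<Prod>v\<in>S. c v ^ Poly_Mapping.lookup m v)"
  unfolding eval_monomial_def
  by (rule prod.mono_neutral_left) (use assms in \<open>auto simp: in_keys_iff\<close>)

lemma eval_mv_poly_superset:
  assumes "finite S" "Poly_Mapping.keys p \<subseteq> S"
  shows "eval_mv_poly p c = (\<Sum>m\<in>S. Poly_Mapping.lookup p m * eval_monomial m c)"
  unfolding eval_mv_poly_def eval_monomial_def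
  by (rule sum.mono_neutral_left) (use assms in \<open>auto simp: in_keys_iff\<close>)

lemma eval_monomial_zero [simp]: "eval_monomial 0 c = 1"
  by (simp add: eval_monomial_def)

lemma eval_monomial_single: "eval_monomial (Poly_Mapping.single v 1) c = c v"
  by (simp add: eval_monomial_def)

lemma eval_monomial_add:
  "eval_monomial (m + m') c = eval_monomial m c * eval_monomial m' c"
proof -
  let ?S = "Poly_Mapping.keys m \<union> Poly_Mapping.keys m'"
  have "Poly_Mapping.keys (m + m') \<subseteq> ?S"
    by (rule Poly_Mapping.keys_add)
  then have "eval_monomial (m + m') c = (\<Prod>v\<in>?S. c v ^ Poly_Mapping.lookup (m + m') v)"
    by (intro eval_monomial_superset) auto
  also have "\<dots> = (\<Prod>v\<in>?S. c v ^ Poly_Mapping.lookup m v) * (\<Prod>v\<in>?S. c v ^ Poly_Mapping.lookup m' v)"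
    by (simp add: lookup_add power_add prod.distrib)
  also have "\<dots> = eval_monomial m c * eval_monomial m' c"
    by (simp add: eval_monomial_superset[of ?S])
  finally show ?thesis .
qed

lemma eval_mv_poly_single:
  "eval_mv_poly (Poly_Mapping.single m a) c = a * eval_monomial m c"
  by (subst eval_mv_poly_superset[of "{m}"]) auto

lemma eval_mv_poly_add: "eval_mv_poly (p + q) c = eval_mv_poly p c + eval_mv_poly q c"
proof -
  let ?S = "Poly_Mapping.keys p \<union> Poly_Mapping.keys q"
  have "Poly_Mapping.keys (p + q) \<subseteq> ?S"
    by (rule Poly_Mapping.keys_add)
  then show ?thesis
    by (simp add: eval_mv_poly_superset[of ?S] lookup_add distrib_right sum.distrib)
qed

lemma mv_polynomial_function_monomial: "mv_polynomial_function (\<lambda>c. a * eval_monomial m c)"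
  unfolding mv_polynomial_function_def using eval_mv_poly_single by blast

lemma mv_polynomial_function_const: "mv_polynomial_function (\<lambda>c. a)"
  using mv_polynomial_function_monomial[of a 0] by simp

lemma mv_polynomial_function_coordinate: "mv_polynomial_function (\<lambda>c. c v)"
  using mv_polynomial_function_monomial[of 1 "Poly_Mapping.single v 1"]
  by (simp add: eval_monomial_single del: One_nat_def)

lemma mv_polynomial_function_add:
  assumes "mv_polynomial_function f" "mv_polynomial_function g"
  shows "mv_polynomial_function (\<lambda>c. f c + g c)"
  using assms unfolding mv_polynomial_function_def by (metis eval_mv_poly_add)

lemma mv_polynomial_function_sum:
  assumes "\<And>i. i \<in> I \<Longrightarrow> mv_polynomial_function (f i)"
  shows "mv_polynomial_function (\<lambda>c. \<Sum>i\<in>I. f i c)"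
  using assms
  by (induction I rule: infinite_finite_induct)
     (auto intro: mv_polynomial_function_const mv_polynomial_function_add)

lemma mv_polynomial_function_mult:
  assumes "mv_polynomial_function f" "mv_polynomial_function g"
  shows "mv_polynomial_function (\<lambda>c. f c * g c)"
proof -
  obtain p q where pq: "\<And>c. eval_mv_poly p c = f c" "\<And>c. eval_mv_poly q c = g c"
    using assms unfolding mv_polynomial_function_def by blast
  have "f c * g c = (\<Sum>m\<in>Poly_Mapping.keys p. \<Sum>m'\<in>Poly_Mapping.keys q.
      (Poly_Mapping.lookup p m * Poly_Mapping.lookup q m') * eval_monomial (m + m') c)" for c
    unfolding pq[symmetric] eval_mv_poly_def eval_monomial_def[symmetric] eval_monomial_add
    by (simp add: sum_product mult_ac)
  then show ?thesis
    by (simp add: mv_polynomial_function_sum mv_polynomial_function_monomial)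
qed

lemma algebraic_set_zeros:
  assumes "\<And>i. mv_polynomial_function (f i)"
  shows "algebraic_set {c. \<forall>i. f i c = 0}"
proof -
  obtain p where "\<And>i c. eval_mv_poly (p i) c = f i c"
    using assms unfolding mv_polynomial_function_def by metis
  then have "{c. \<forall>i. f i c = 0} = {c. \<forall>q\<in>range p. eval_mv_poly q c = 0}"
    by auto
  then show ?thesis
    unfolding algebraic_set_def by blast
qed

section \<open>Structures satisfying an operator identity\<close>

lemma mv_polynomial_function_product_of:
  assumes "\<And>k. mv_polynomial_function (\<lambda>c. F c $ k)" "\<And>k. mv_polynomial_function (\<lambda>c. G c $ k)"
  shows "mv_polynomial_function (\<lambda>c. product_of c (F c) (G c) $ k)"
  unfolding product_of_def vec_lambda_beta
  by (intro mv_polynomial_function_sum mv_polynomial_function_mult mv_polynomial_function_coordinate assms)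

lemma eval_word_Nil [simp]: "eval_word mul x [] y = y"
  and eval_word_Cons [simp]:
    "eval_word mul x (s # w) y = eval_symbol mul x s (eval_word mul x w y)"
  by (simp_all add: eval_word_def)

lemma mv_polynomial_function_eval_word:
  "mv_polynomial_function (\<lambda>c. eval_word (product_of c) x w y $ k)"
proof (induction w arbitrary: k)
  case Nil
  show ?case by (simp add: mv_polynomial_function_const)
next
  case (Cons s w)
  then show ?case
    by (cases s) (auto intro!: mv_polynomial_function_product_of mv_polynomial_function_const)
qed

lemma mv_polynomial_function_eval_op_poly:
  "mv_polynomial_function (\<lambda>c. eval_op_poly (*s) (product_of c) T x y $ k)"
  unfolding eval_op_poly_def sum_component vector_smult_component
  by (intro mv_polynomial_function_sum mv_polynomial_function_mult mv_polynomial_function_const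
      mv_polynomial_function_eval_word)

text \<open>Each triple of operator arguments, vector and coordinate contributes one polynomial
  equation in the structure constants.\<close>

lemma algebraic_set_operator_identity:
  "algebraic_set {c :: ('n::finite, 'k::field) struct_consts.
     operator_identity (*s) (product_of c) T}"
proof -
  let ?f = "\<lambda>(x, y, k) (c :: ('n, 'k) struct_consts). eval_op_poly (*s) (product_of c) T x y $ k"
  have "{c. operator_identity (*s) (product_of c) T} = {c. \<forall>i. ?f i c = 0}"
    by (auto simp: operator_identity_def fun_eq_iff vec_eq_iff)
  moreover have "algebraic_set {c. \<forall>i. ?f i c = 0}"
    by (rule algebraic_set_zeros) (simp add: mv_polynomial_function_eval_op_poly split: prod.split)
  ultimately show ?thesis by simp
qed

section \<open>Invariance under isomorphism\<close>

lemma eval_word_hom: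
  assumes "\<And>a b. \<phi> (mul a b) = mul' (\<phi> a) (\<phi> b)"
  shows "\<phi> (eval_word mul x w y) = eval_word mul' (\<phi> \<circ> x) w (\<phi> y)"
proof (induction w)
  case (Cons s w)
  then show ?case by (cases s) (simp_all add: assms)
qed simp

lemma eval_op_poly_hom:
  assumes "Vector_Spaces.linear scl scl' \<phi>" and "\<And>a b. \<phi> (mul a b) = mul' (\<phi> a) (\<phi> b)"
  shows "\<phi> (eval_op_poly scl mul T x y) = eval_op_poly scl' mul' T (\<phi> \<circ> x) (\<phi> y)"
proof -
  interpret Vector_Spaces.linear scl scl' \<phi> by fact
  have "\<phi> (eval_word mul x w y) = eval_word mul' (\<phi> \<circ> x) w (\<phi> y)" for w
    by (rule eval_word_hom) (rule assms(2))
  then show ?thesis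
    unfolding eval_op_poly_def by (simp add: sum scale)
qed

lemma operator_identity_iso:
  fixes T :: "('i, 'k::field) op_poly"
  assumes "Vector_Spaces.linear scl scl' \<phi>" and "bij \<phi>"
    and "\<And>a b. \<phi> (mul a b) = mul' (\<phi> a) (\<phi> b)"
  shows "operator_identity scl mul T \<longleftrightarrow> operator_identity scl' mul' T"
proof
  interpret Vector_Spaces.linear scl scl' \<phi> by fact
  have hom: "\<phi> (eval_op_poly scl mul T x y) = eval_op_poly scl' mul' T (\<phi> \<circ> x) (\<phi> y)" for x y
    by (rule eval_op_poly_hom) (use assms in auto)
  show "operator_identity scl' mul' T" if "operator_identity scl mul T"
    unfolding operator_identity_def
  proof (intro allI ext)
    fix x :: "'i \<Rightarrow> _" and y
    have "x = \<phi> \<circ> (inv \<phi> \<circ> x)" "y = \<phi> (inv \<phi> y)"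
      using \<open>bij \<phi>\<close> by (auto simp: fun_eq_iff bij_is_surj surj_f_inv_f)
    then have "eval_op_poly scl' mul' T x y
        = \<phi> (eval_op_poly scl mul T (inv \<phi> \<circ> x) (inv \<phi> y))"
      using hom by metis
    also have "\<dots> = 0"
      using that by (simp add: operator_identity_def zero)
    finally show "eval_op_poly scl' mul' T x y = 0" .
  qed
  show "operator_identity scl mul T" if "operator_identity scl' mul' T"
    unfolding operator_identity_def
  proof (intro allI ext)
    fix x y
    have "\<phi> (eval_op_poly scl mul T x y) = \<phi> 0"
      using that by (simp add: hom operator_identity_def zero)
    then show "eval_op_poly scl mul T x y = 0"
      by (rule injD[OF bij_is_inj[OF \<open>bij \<phi>\<close>]])
  qed
qed

lemma operator_identity_represents:
  assumes "represents c scl mul"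
  shows "operator_identity (*s) (product_of c) T \<longleftrightarrow> operator_identity scl mul T"
proof -
  obtain \<phi> where "Vector_Spaces.linear (*s) scl \<phi>" "bij \<phi>"
    "\<And>x y. \<phi> (product_of c x y) = mul (\<phi> x) (\<phi> y)"
    using assms unfolding represents_def by blast
  then show ?thesis by (rule operator_identity_iso)
qed

section \<open>Orbits\<close>

lemma vec_eq_sum_axis: "(x :: 'k::field ^ 'n::finite) = (\<Sum>i\<in>UNIV. x $ i *s axis i 1)"
  by (simp add: vec_eq_iff axis_def if_distrib cong: if_cong)

text \<open>A bilinear product is recovered from its structure constants. This identifies a point of an
  orbit, which is only a tuple of structure constants, with the transported product.\<close>

lemma product_of_consts_of:
  fixes \<mu> :: "'k::field ^ 'n::finite \<Rightarrow> 'k ^ 'n \<Rightarrow> 'k ^ 'n"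
  assumes "\<And>y. Vector_Spaces.linear (*s) (*s) (\<lambda>x. \<mu> x y)"
    and "\<And>x. Vector_Spaces.linear (*s) (*s) (\<mu> x)"
  shows "product_of (consts_of \<mu>) = \<mu>"
proof (intro ext)
  fix x y
  have left: "\<mu> x y = (\<Sum>i\<in>UNIV. x $ i *s \<mu> (axis i 1) y)"
  proof -
    interpret Vector_Spaces.linear "(*s)" "(*s)" "\<lambda>x. \<mu> x y" by fact
    show ?thesis by (subst vec_eq_sum_axis[of x]) (simp add: sum scale)
  qed
  have right: "\<mu> a y = (\<Sum>j\<in>UNIV. y $ j *s \<mu> a (axis j 1))" for a
  proof -
    interpret Vector_Spaces.linear "(*s)" "(*s)" "\<mu> a" by fact
    show ?thesis by (subst vec_eq_sum_axis[of y]) (simp add: sum scale)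
  qed
  show "product_of (consts_of \<mu>) x y = \<mu> x y"
    unfolding left
    unfolding right
    by (simp add: vec_eq_iff product_of_def consts_of_def sum_distrib_left mult_ac)
qed

lemma linear_product_of_left: "Vector_Spaces.linear (*s) (*s) (\<lambda>x. product_of c x y)"
  by (unfold_locales)
     (simp_all add: vec_eq_iff product_of_def algebra_simps sum.distrib sum_distrib_left)

lemma linear_product_of_right: "Vector_Spaces.linear (*s) (*s) (product_of c x)"
  by (unfold_locales)
     (simp_all add: vec_eq_iff product_of_def algebra_simps sum.distrib sum_distrib_left)

lemma product_of_consts_of_gl_act:
  "product_of (consts_of (gl_act g (product_of c))) = gl_act g (product_of c)"
proof (rule product_of_consts_of)
  let ?h = "matrix_inv g"
  note lin = matrix_vector_mul_linear_gen
  show "Vector_Spaces.linear (*s) (*s) (\<lambda>x. gl_act g (product_of c) x y)" for y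
    using Vector_Spaces.linear_compose[OF Vector_Spaces.linear_compose[OF lin[of ?h]
        linear_product_of_left[of c "?h *v y"]] lin[of g]]
    by (simp add: gl_act_def[abs_def] o_def)
  show "Vector_Spaces.linear (*s) (*s) (gl_act g (product_of c) x)" for x
    using Vector_Spaces.linear_compose[OF Vector_Spaces.linear_compose[OF lin[of ?h]
        linear_product_of_right[of c "?h *v x"]] lin[of g]]
    by (simp add: gl_act_def[abs_def] o_def)
qed

lemma operator_identity_gl_orbit:
  fixes c :: "('n::finite, 'k::field) struct_consts"
  assumes "operator_identity (*s) (product_of c) T" and "c' \<in> gl_orbit c"
  shows "operator_identity (*s) (product_of c') T"
proof -
  obtain g :: "'k ^ 'n ^ 'n" where g: "invertible g" and
    c': "product_of c' = gl_act g (product_of c)"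
    using assms(2) unfolding gl_orbit_def by (auto simp: product_of_consts_of_gl_act)
  have "\<exists>h. g ** h = mat 1 \<and> h ** g = mat 1"
    using g unfolding invertible_def .
  then have inv: "matrix_inv g ** g = mat 1"
    unfolding matrix_inv_def by (rule someI2_ex) simp
  have "g *v product_of c a b = product_of c' (g *v a) (g *v b)" for a b
    by (simp add: c' gl_act_def matrix_vector_mul_assoc inv)
  with g have "operator_identity (*s) (product_of c) T \<longleftrightarrow> operator_identity (*s) (product_of c') T"
    by (intro operator_identity_iso[of _ _ "(*v) g"])
       (auto simp: invertible_eq_bij matrix_vector_mul_linear_gen)
  with assms(1) show ?thesis by simp
qed

section \<open>Operator identities obstruct degeneration\<close>

text \<open>An operator identity defines a closed set containing the orbit, and the closure of the orbit
  is the smallest such set.\<close>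

lemma operator_identity_degeneration:
  assumes "operator_identity (*s) (product_of c) T" and "struct_degenerates c d"
  shows "operator_identity (*s) (product_of d) T"
proof -
  have "zariski_closure (gl_orbit c) \<subseteq> {c'. operator_identity (*s) (product_of c') T}"
    unfolding zariski_closure_def
    by (rule hull_minimal)
       (auto intro: operator_identity_gl_orbit[OF assms(1)] algebraic_set_operator_identity)
  then show ?thesis
    using assms(2) unfolding struct_degenerates_def by blast
qed

theorem lemma3p1:
  fixes sclA :: "'k::field \<Rightarrow> 'a::ab_group_add \<Rightarrow> 'a"
    and mulA :: "'a \<Rightarrow> 'a \<Rightarrow> 'a"
    and sclB :: "'k \<Rightarrow> 'b::ab_group_add \<Rightarrow> 'b"
    and mulB :: "'b \<Rightarrow> 'b \<Rightarrow> 'b"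
    and T :: "('n::finite, 'k) op_poly"
  assumes "pre_lie_algebra sclA mulA"
    and "vector_space.dim sclA (UNIV :: 'a set) = CARD('n)"
    and "pre_lie_algebra sclB mulB"
    and "vector_space.dim sclB (UNIV :: 'b set) = CARD('n)"
    and "operator_identity sclA mulA T"
    and "\<not> operator_identity sclB mulB T"
  shows "\<not> degenerates TYPE('n) sclA mulA sclB mulB"
proof
  assume "degenerates TYPE('n) sclA mulA sclB mulB"
  then obtain c d :: "('n, 'k) struct_consts" where c: "represents c sclA mulA"
    and d: "represents d sclB mulB" and deg: "struct_degenerates c d"
    unfolding degenerates_def by blast
  have "operator_identity (*s) (product_of c) T"
    using assms(5) by (simp add: operator_identity_represents[OF c])
  then have "operator_identity (*s) (product_of d) T"
    using deg by (rule operator_identity_degeneration)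
  then have "operator_identity sclB mulB T"
    by (simp add: operator_identity_represents[OF d])
  with assms(6) show False by simp
qed

end
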